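(* Let $(g_1,g_2)$ and $(\hat g_1,\hat g_2)$ be two pairs of holomorphic functions of $z=u+\mathrm{i}v$ on a common connected domain, with $g_1'g_2'\neq0$, $g_1\overline{g_2}\neq-1$ and $\hat g_1'\hat g_2'\neq0$, $\hat g_1\overline{\hat g_2}\neq-1$ at every point. Then the two pairs generate, by means of the formulas $$K=|\alpha|\,\mathrm{Re}\,\alpha,\qquad \varkappa=|\alpha|\,\mathrm{Im}\,\alpha,\qquad \alpha=\frac{-4\,g_1'\,\overline{g_2'}}{(1+g_1\overline{g_2})^2}$$ (and the same formulas with $\hat g_1,\hat g_2$ in place of $g_1,g_2$), one and the same solution $(K,\varkappa)$ to the system $$(K^2+\varkappa^2)^{\frac14}\,\Delta\ln(K^2+\varkappa^2)^{\frac14}=2K,\qquad (K^2+\varkappa^2)^{\frac14}\,\Delta\arctan\frac{\varkappa}{K}=2\varkappa,$$ if and only if they are related by equalities of the type $$\hat g_1=\frac{a g_1+b}{c g_1+d},\qquad \hat g_2=\frac{\bar d\, g_2-\bar c}{-\bar b\, g_2+\bar a},$$ where $a,b,c,d\in\mathbb{C}$, $ad-bc\neq0$.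
   Context: Here $(u,v)$ are real coordinates on a domain in $\mathbb{R}^2\cong\mathbb{C}$, $z=u+\mathrm{i}v$, and $\Delta=\partial_u^2+\partial_v^2$. A prime on a holomorphic function denotes the derivative with respect to $z$; a bar denotes complex conjugation. Solutions $(K,\varkappa)$ of the system are pairs of smooth real-valued functions with $K^2+\varkappa^2\neq0$ everywhere, and $\arctan\frac{\varkappa}{K}$ is understood as a smooth local branch $Y$ of the argument of $K+\mathrm{i}\varkappa$; that is, writing locally $K=e^{2X}\cos Y$, $\varkappa=e^{2X}\sin Y$ with $X,Y$ smooth and real, the system reads $\Delta X=2e^X\cos Y$, $\Delta Y=2e^X\sin Y$. Every pair $(g_1,g_2)$ satisfying the stated conditions generates a solution of the system by the given formulas. The constants $a,b,c,d$ are the same in both equalities relating the two pairs. All considerations are local. *)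

theory Defs
  imports "HOL-Complex_Analysis.Complex_Analysis"
begin

text \<open>The plane with real coordinates (u, v) is identified with the complex numbers via
  z = u + i v, so real-valued functions of (u, v) have type \<open>complex \<Rightarrow> real\<close>.\<close>

definition pderiv_u :: "(complex \<Rightarrow> real) \<Rightarrow> complex \<Rightarrow> real" where
  "pderiv_u f z = deriv (\<lambda>u. f (Complex u (Im z))) (Re z)"

definition pderiv_v :: "(complex \<Rightarrow> real) \<Rightarrow> complex \<Rightarrow> real" where
  "pderiv_v f z = deriv (\<lambda>v. f (Complex (Re z) v)) (Im z)"

definition laplacian :: "(complex \<Rightarrow> real) \<Rightarrow> complex \<Rightarrow> real" where
  "laplacian f z = pderiv_u (pderiv_u f) z + pderiv_v (pderiv_v f) z"

text \<open>On an open set: all iterated partial derivatives up to order \<open>k\<close> exist and are continuous.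
  Existence has to be demanded explicitly, since \<^const>\<open>deriv\<close> is total.\<close>

fun Ck_on :: "nat \<Rightarrow> complex set \<Rightarrow> (complex \<Rightarrow> real) \<Rightarrow> bool" where
  "Ck_on 0 D f \<longleftrightarrow> continuous_on D f"
| "Ck_on (Suc k) D f \<longleftrightarrow>
     continuous_on D f \<and>
     (\<forall>z\<in>D. (\<lambda>u. f (Complex u (Im z))) differentiable (at (Re z)) \<and>
             (\<lambda>v. f (Complex (Re z) v)) differentiable (at (Im z))) \<and>
     Ck_on k D (pderiv_u f) \<and> Ck_on k D (pderiv_v f)"

definition smooth_on :: "complex set \<Rightarrow> (complex \<Rightarrow> real) \<Rightarrow> bool" where
  "smooth_on D f \<longleftrightarrow> (\<forall>k. Ck_on k D f)"

text \<open>A smooth branch of the argument of \<open>K + i \<kappa>\<close>, which is the meaning of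
  \<open>arctan (\<kappa> / K)\<close> in the system below (\<open>K\<close> may vanish).\<close>

definition arg_branch_on ::
  "complex set \<Rightarrow> (complex \<Rightarrow> real) \<Rightarrow> (complex \<Rightarrow> real) \<Rightarrow> (complex \<Rightarrow> real) \<Rightarrow> bool" where
  "arg_branch_on U K \<kappa> Y \<longleftrightarrow>
     smooth_on U Y \<and>
     (\<forall>z\<in>U. K z = sqrt ((K z)\<^sup>2 + (\<kappa> z)\<^sup>2) * cos (Y z) \<and>
             \<kappa> z = sqrt ((K z)\<^sup>2 + (\<kappa> z)\<^sup>2) * sin (Y z))"

text \<open>Continuous branches of the argument differ locally by a constant, so the second equation
  does not depend on the branch \<open>Y\<close>; branches exist only locally in general.\<close>

definition solution_on ::
  "complex set \<Rightarrow> (complex \<Rightarrow> real) \<Rightarrow> (complex \<Rightarrow> real) \<Rightarrow> bool" where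
  "solution_on D K \<kappa> \<longleftrightarrow>
     smooth_on D K \<and> smooth_on D \<kappa> \<and>
     (\<forall>z\<in>D. (K z)\<^sup>2 + (\<kappa> z)\<^sup>2 \<noteq> 0) \<and>
     (\<forall>z\<in>D. ((K z)\<^sup>2 + (\<kappa> z)\<^sup>2) powr (1/4) *
              laplacian (\<lambda>w. ln (((K w)\<^sup>2 + (\<kappa> w)\<^sup>2) powr (1/4))) z = 2 * K z) \<and>
     (\<forall>z\<in>D. \<exists>U Y. open U \<and> z \<in> U \<and> U \<subseteq> D \<and> arg_branch_on U K \<kappa> Y \<and>
        (\<forall>w\<in>U. ((K w)\<^sup>2 + (\<kappa> w)\<^sup>2) powr (1/4) * laplacian Y w = 2 * \<kappa> w))"

definition alpha :: "(complex \<Rightarrow> complex) \<Rightarrow> (complex \<Rightarrow> complex) \<Rightarrow> complex \<Rightarrow> complex" where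
  "alpha g1 g2 z = - 4 * deriv g1 z * cnj (deriv g2 z) / (1 + g1 z * cnj (g2 z))\<^sup>2"

definition generates_on ::
  "complex set \<Rightarrow> (complex \<Rightarrow> complex) \<Rightarrow> (complex \<Rightarrow> complex) \<Rightarrow>
     (complex \<Rightarrow> real) \<Rightarrow> (complex \<Rightarrow> real) \<Rightarrow> bool" where
  "generates_on D g1 g2 K \<kappa> \<longleftrightarrow>
     (\<forall>z\<in>D. K z = cmod (alpha g1 g2 z) * Re (alpha g1 g2 z) \<and>
             \<kappa> z = cmod (alpha g1 g2 z) * Im (alpha g1 g2 z))"

end

theory Submission
  imports Defs
begin

text \<open>Write \<open>\<partial>\<close> and \<open>\<partial>'\<close> for the Wirtinger derivatives, which satisfy
  \<open>\<Delta> = 4 \<partial> \<partial>'\<close>. A pair \<open>K + i \<kappa> = |\<alpha>| \<alpha>\<close> determines \<open>\<alpha>\<close>, so the question is when two pairs of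
  holomorphic functions have the same \<open>\<alpha>\<close>, plus the fact that every such \<open>\<alpha>\<close> gives a solution.

  For the latter, put \<open>log \<alpha> = X + i Y\<close> with a local branch of the logarithm. The system becomes
  \<open>\<Delta> (X + i Y) = 2 \<alpha>\<close>. Up to harmonic terms \<open>log \<alpha>\<close> is \<open>- 2 log (1 + g1 cnj g2)\<close>, and
  applying \<open>4 \<partial> \<partial>'\<close> to this gives exactly \<open>2 \<alpha>\<close>
  (\<open>log_alpha_branch\<close>, \<open>generated_solution\<close>). Smoothness is checked on complex-valued functions
  with iterated Wirtinger derivatives, a class visibly closed under all operations that occur.

  A Moebius change of \<open>g1\<close> together with the inverse adjoint change of \<open>g2\<close> multiplies \<open>1 + g1 cnj g2\<close> by a
  factor that cancels against the derivatives (\<open>alpha_moebius_invariant\<close>); this is one implication.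

  Conversely, let \<open>\<alpha>\<close> be the same for both pairs. After clearing denominators this is a finite sum
  of terms \<open>p(z) cnj(q(z))\<close> that vanishes identically, with \<open>p\<close>, \<open>q\<close> holomorphic. Then the two
  variables separate: the sum of \<open>p(z) cnj(q(w))\<close> vanishes for all \<open>z\<close>, \<open>w\<close> (\<open>polarization\<close>).
  With \<open>w\<close> fixed, the identity reads
  \<open>h1' / (1 + q h1)\<^sup>2 = const * g1' / (1 + p g1)\<^sup>2\<close>. Both sides are derivatives of Moebius functions
  of \<open>h1\<close> and \<open>g1\<close>, so \<open>h1\<close> is a Moebius function of \<open>g1\<close> (\<open>moebius_of_alpha_eq\<close>). Inserting
  this into the separated identity and comparing logarithmic derivatives in \<open>z\<close> at \<open>z = w\<close>
  leaves no freedom for \<open>h2\<close> (\<open>second_moebius_of_first\<close>).\<close>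

section \<open>Wirtinger derivatives\<close>

text \<open>\<open>A\<close> and \<open>B\<close> are the classical \<open>\<partial>f/\<partial>z\<close> and \<open>\<partial>f/\<partial>(cnj z)\<close> of a real-differentiable \<open>f\<close>.\<close>

definition has_wirtinger_deriv ::
  "(complex \<Rightarrow> complex) \<Rightarrow> complex \<Rightarrow> complex \<Rightarrow> complex \<Rightarrow> bool" where
  "has_wirtinger_deriv f A B z \<longleftrightarrow> (f has_derivative (\<lambda>h. A * h + B * cnj h)) (at z)"

lemma wirtinger_cong_on:
  assumes "has_wirtinger_deriv f A B z" "open D" "z \<in> D" "\<And>w. w \<in> D \<Longrightarrow> f w = g w"
  shows "has_wirtinger_deriv g A B z"
  using assms unfolding has_wirtinger_deriv_def
  by (blast intro: has_derivative_transform_within_open)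

lemma wirtinger_eq_rhs:
  assumes "has_wirtinger_deriv f A B z" "A = A'" "B = B'"
  shows "has_wirtinger_deriv f A' B' z"
  using assms by simp

lemma wirtinger_const: "has_wirtinger_deriv (\<lambda>_. c) 0 0 z"
  by (simp add: has_wirtinger_deriv_def)

lemma wirtinger_field_deriv:
  assumes "(f has_field_derivative A) (at z)"
  shows "has_wirtinger_deriv f A 0 z"
  using assms by (simp add: has_wirtinger_deriv_def has_field_derivative_def)

lemma wirtinger_holomorphic:
  assumes "f holomorphic_on D" "open D" "z \<in> D"
  shows "has_wirtinger_deriv f (deriv f z) 0 z"
  using assms by (intro wirtinger_field_deriv holomorphic_derivI)

lemma wirtinger_add:
  assumes "has_wirtinger_deriv f A B z" "has_wirtinger_deriv g A' B' z"
  shows "has_wirtinger_deriv (\<lambda>w. f w + g w) (A + A') (B + B') z"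
  using has_derivative_add[OF assms[unfolded has_wirtinger_deriv_def]]
  by (simp add: has_wirtinger_deriv_def algebra_simps)

lemma wirtinger_mult:
  assumes "has_wirtinger_deriv f A B z" "has_wirtinger_deriv g A' B' z"
  shows "has_wirtinger_deriv (\<lambda>w. f w * g w) (A * g z + f z * A') (B * g z + f z * B') z"
  using has_derivative_mult[OF assms[unfolded has_wirtinger_deriv_def]]
  by (simp add: has_wirtinger_deriv_def algebra_simps)

lemma wirtinger_cnj:
  assumes "has_wirtinger_deriv f A B z"
  shows "has_wirtinger_deriv (\<lambda>w. cnj (f w)) (cnj B) (cnj A) z"
  using bounded_linear.has_derivative[OF bounded_linear_cnj assms[unfolded has_wirtinger_deriv_def]]
  by (simp add: has_wirtinger_deriv_def algebra_simps)

lemma wirtinger_chain: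
  assumes "has_wirtinger_deriv f A B z" "(\<phi> has_field_derivative c) (at (f z))"
  shows "has_wirtinger_deriv (\<lambda>w. \<phi> (f w)) (c * A) (c * B) z"
  using has_derivative_compose[OF assms(1)[unfolded has_wirtinger_deriv_def]
      assms(2)[unfolded has_field_derivative_def]]
  by (simp add: has_wirtinger_deriv_def algebra_simps)

lemma wirtinger_inverse:
  assumes "has_wirtinger_deriv f A B z" "f z \<noteq> 0"
  shows "has_wirtinger_deriv (\<lambda>w. inverse (f w)) (- A * inverse (f z) * inverse (f z))
     (- B * inverse (f z) * inverse (f z)) z"
  using wirtinger_chain[OF assms(1) DERIV_inverse[OF assms(2)]]
  by (simp add: algebra_simps power2_eq_square)

text \<open>From \<open>|f|\<^sup>2 = f cnj f\<close>: the modulus stays in the class because its derivatives are rational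
  in \<open>f\<close>, \<open>|f|\<close>, the derivatives of \<open>f\<close> and their conjugates.\<close>

lemma wirtinger_cmod:
  assumes "has_wirtinger_deriv f A B z" "f z \<noteq> 0"
  shows "has_wirtinger_deriv (\<lambda>w. of_real (cmod (f w)))
           ((cnj (f z) * A + f z * cnj B) * inverse (2 * of_real (cmod (f z))))
           ((cnj (f z) * B + f z * cnj A) * inverse (2 * of_real (cmod (f z)))) z"
proof -
  have *: "((\<lambda>w. cmod (f w)) has_derivative (\<lambda>h. (A * h + B * cnj h) \<bullet> sgn (f z))) (at z)"
    using has_derivative_compose[OF assms(1)[unfolded has_wirtinger_deriv_def] has_derivative_norm[OF assms(2)]]
    by simp
  have "(of_real ((A * h + B * cnj h) \<bullet> sgn (f z)) :: complex) =
      (cnj (f z) * A + f z * cnj B) * inverse (2 * of_real (cmod (f z))) * h +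
      (cnj (f z) * B + f z * cnj A) * inverse (2 * of_real (cmod (f z))) * cnj h" for h
  proof -
    have "x \<bullet> sgn y = Re (x * cnj y) * inverse (cmod y)" for x y
      by (simp add: inner_complex_def sgn_div_norm algebra_simps)
    moreover have "of_real (Re (x * cnj y)) = (x * cnj y + y * cnj x) / 2" for x y
      by (simp add: complex_eq_iff)
    ultimately show ?thesis
      by (simp only: of_real_mult) (simp add: algebra_simps)
  qed
  then show ?thesis using bounded_linear.has_derivative[OF bounded_linear_of_real[where 'a=complex] *]
    by (simp add: has_wirtinger_deriv_def)
qed

text \<open>Testing the differential in the directions \<open>1\<close> and \<open>\<i>\<close> isolates \<open>A + B\<close> and \<open>A - B\<close>.
  This is what lets an identity between functions of \<open>z\<close> and \<open>cnj z\<close> be differentiated with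
  respect to \<open>z\<close> alone.\<close>

lemma wirtinger_unique_zero:
  assumes "has_wirtinger_deriv (\<lambda>_. 0) A B z"
  shows "A = 0 \<and> B = 0"
proof -
  have eq: "(\<lambda>h. A * h + B * cnj h) = (\<lambda>h. 0)"
    using has_derivative_unique[OF assms[unfolded has_wirtinger_deriv_def] has_derivative_const] .
  have "A + B = 0" "A - B = 0"
    using fun_cong[OF eq, of 1] fun_cong[OF eq, of \<i>] by (auto simp: complex_eq_iff)
  then show ?thesis by simp
qed

section \<open>Smooth functions and the Laplacian in Wirtinger terms\<close>

text \<open>Complex-valued functions of class \<open>C\<^sup>k\<close>. Asking for some pair of functions that are the
  derivatives on \<open>D\<close>, instead of fixing derivative operators, spares all congruence arguments and
  makes the closure properties plain inductions.\<close>

fun wirtinger_Ck :: "nat \<Rightarrow> complex set \<Rightarrow> (complex \<Rightarrow> complex) \<Rightarrow> bool" where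
  "wirtinger_Ck 0 D f \<longleftrightarrow> continuous_on D f"
| "wirtinger_Ck (Suc k) D f \<longleftrightarrow>
     (\<exists>A B. (\<forall>z\<in>D. has_wirtinger_deriv f (A z) (B z) z) \<and> wirtinger_Ck k D A \<and> wirtinger_Ck k D B)"

lemma wirtinger_continuous:
  assumes "\<And>z. z \<in> D \<Longrightarrow> has_wirtinger_deriv f (A z) (B z) z"
  shows "continuous_on D f"
  using assms unfolding has_wirtinger_deriv_def
  by (meson continuous_at_imp_continuous_on has_derivative_continuous)

lemma wirtinger_Ck_Suc_imp: "wirtinger_Ck (Suc k) D f \<Longrightarrow> wirtinger_Ck k D f"
proof (induction k arbitrary: f)
  case 0
  then show ?case by (auto intro: wirtinger_continuous)
next
  case (Suc k)
  then obtain A B where "\<forall>z\<in>D. has_wirtinger_deriv f (A z) (B z) z"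
    "wirtinger_Ck (Suc k) D A" "wirtinger_Ck (Suc k) D B"
    unfolding wirtinger_Ck.simps(2)[of "Suc k"] by blast
  with Suc.IH show ?case unfolding wirtinger_Ck.simps(2)[of "k"] by blast
qed

lemma wirtinger_Ck_SucI:
  assumes "\<And>z. z \<in> D \<Longrightarrow> has_wirtinger_deriv f (A z) (B z) z" "wirtinger_Ck k D A" "wirtinger_Ck k D B"
  shows "wirtinger_Ck (Suc k) D f"
  using assms by auto

lemma wirtinger_Ck_SucE:
  assumes "wirtinger_Ck (Suc k) D f"
  obtains A B where "\<And>z. z \<in> D \<Longrightarrow> has_wirtinger_deriv f (A z) (B z) z" "wirtinger_Ck k D A" "wirtinger_Ck k D B"
  using assms by auto

lemma wirtinger_Ck_const: "wirtinger_Ck k D (\<lambda>_. c)"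
proof (induction k arbitrary: c)
  case (Suc k)
  show ?case by (rule wirtinger_Ck_SucI[OF wirtinger_const Suc Suc])
qed simp

lemma wirtinger_Ck_holomorphic:
  assumes "open D" "f holomorphic_on D"
  shows "wirtinger_Ck k D f"
  using assms(2)
proof (induction k arbitrary: f)
  case 0
  then show ?case by (simp add: holomorphic_on_imp_continuous_on)
next
  case (Suc k)
  show ?case
    by (rule wirtinger_Ck_SucI[OF wirtinger_holomorphic])
       (use Suc assms(1) wirtinger_Ck_const in \<open>auto intro: holomorphic_deriv\<close>)
qed

lemma wirtinger_Ck_add:
  assumes "wirtinger_Ck k D f" "wirtinger_Ck k D g"
  shows "wirtinger_Ck k D (\<lambda>z. f z + g z)"
  using assms
proof (induction k arbitrary: f g)
  case 0
  then show ?case by (auto intro: continuous_intros)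
next
  case (Suc k)
  from Suc.prems show ?case
    by (elim wirtinger_Ck_SucE) (rule wirtinger_Ck_SucI[OF wirtinger_add], auto intro: Suc.IH)
qed

lemma wirtinger_Ck_cnj:
  assumes "wirtinger_Ck k D f"
  shows "wirtinger_Ck k D (\<lambda>z. cnj (f z))"
  using assms
proof (induction k arbitrary: f)
  case 0
  then show ?case by (auto intro: continuous_intros)
next
  case (Suc k)
  from Suc.prems show ?case
    by (elim wirtinger_Ck_SucE) (rule wirtinger_Ck_SucI[OF wirtinger_cnj], auto intro: Suc.IH)
qed

lemma wirtinger_Ck_mult:
  assumes "wirtinger_Ck k D f" "wirtinger_Ck k D g"
  shows "wirtinger_Ck k D (\<lambda>z. f z * g z)"
  using assms
proof (induction k arbitrary: f g)
  case 0
  then show ?case by (auto intro: continuous_intros)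
next
  case (Suc k)
  from Suc.prems[THEN wirtinger_Ck_Suc_imp] Suc.prems show ?case
    by (elim wirtinger_Ck_SucE)
       (rule wirtinger_Ck_SucI[OF wirtinger_mult], auto intro!: Suc.IH wirtinger_Ck_add)
qed

lemma wirtinger_Ck_inverse:
  assumes "wirtinger_Ck k D f" "\<And>z. z \<in> D \<Longrightarrow> f z \<noteq> 0"
  shows "wirtinger_Ck k D (\<lambda>z. inverse (f z))"
  using assms
proof (induction k arbitrary: f)
  case 0
  then show ?case by (auto intro: continuous_intros)
next
  case (Suc k)
  have "wirtinger_Ck k D (\<lambda>z. - A z)" if "wirtinger_Ck k D A" for A
    using wirtinger_Ck_mult[OF wirtinger_Ck_const[of _ _ "-1"] that] by simp
  with Suc.IH[OF wirtinger_Ck_Suc_imp[OF Suc.prems(1)]] Suc.prems show ?case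
    by (elim wirtinger_Ck_SucE)
       (rule wirtinger_Ck_SucI[OF wirtinger_inverse], auto intro!: wirtinger_Ck_mult)
qed

lemma wirtinger_Ck_cmod:
  assumes "wirtinger_Ck k D f" "\<And>z. z \<in> D \<Longrightarrow> f z \<noteq> 0"
  shows "wirtinger_Ck k D (\<lambda>z. of_real (cmod (f z)))"
  using assms
proof (induction k arbitrary: f)
  case 0
  then show ?case by (auto intro: continuous_intros)
next
  case (Suc k)
  note f = wirtinger_Ck_Suc_imp[OF Suc.prems(1)]
  have "wirtinger_Ck k D (\<lambda>z. inverse (2 * of_real (cmod (f z))))"
    by (intro wirtinger_Ck_inverse wirtinger_Ck_mult wirtinger_Ck_const Suc.IH f) (use Suc.prems in auto)
  moreover obtain A B where "\<And>z. z \<in> D \<Longrightarrow> has_wirtinger_deriv f (A z) (B z) z"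
      "wirtinger_Ck k D A" "wirtinger_Ck k D B"
    using Suc.prems(1) by (rule wirtinger_Ck_SucE) blast
  ultimately show ?case using f Suc.prems(2)
    by (intro wirtinger_Ck_SucI[OF wirtinger_cmod] wirtinger_Ck_mult wirtinger_Ck_add wirtinger_Ck_cnj) blast+
qed

text \<open>In real coordinates \<open>\<partial>\<^sub>u = \<partial> + \<partial>'\<close> and \<open>\<partial>\<^sub>v = \<i> (\<partial> - \<partial>')\<close>. Only the real part is treated;
  imaginary parts are real parts after multiplication by \<open>- \<i>\<close>.\<close>

lemma Re_wirtinger_u:
  assumes "has_wirtinger_deriv f A B z"
  shows "((\<lambda>u. Re (f (Complex u (Im z)))) has_field_derivative Re (A + B)) (at (Re z))"
proof -
  have "((\<lambda>u. Complex u (Im z)) has_derivative (\<lambda>h. of_real h)) (at (Re z))"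
    unfolding Complex_eq by (auto intro!: derivative_eq_intros)
  from has_derivative_compose[OF this, of f "\<lambda>h. A * h + B * cnj h"] assms
  have "((\<lambda>u. f (Complex u (Im z))) has_derivative (\<lambda>h. A * of_real h + B * of_real h)) (at (Re z))"
    by (simp add: has_wirtinger_deriv_def)
  from bounded_linear.has_derivative[OF bounded_linear_Re this]
  show ?thesis unfolding has_field_derivative_def
    by (rule has_derivative_eq_rhs) (simp add: fun_eq_iff algebra_simps)
qed

lemma Re_wirtinger_v:
  assumes "has_wirtinger_deriv f A B z"
  shows "((\<lambda>v. Re (f (Complex (Re z) v))) has_field_derivative Re (\<i> * (A - B))) (at (Im z))"
proof -
  have "((\<lambda>v. Complex (Re z) v) has_derivative (\<lambda>h. \<i> * of_real h)) (at (Im z))"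
    unfolding Complex_eq by (auto intro!: derivative_eq_intros)
  from has_derivative_compose[OF this, of f "\<lambda>h. A * h + B * cnj h"] assms
  have "((\<lambda>v. f (Complex (Re z) v)) has_derivative (\<lambda>h. A * (\<i> * of_real h) + B * cnj (\<i> * of_real h))) (at (Im z))"
    by (simp add: has_wirtinger_deriv_def)
  from bounded_linear.has_derivative[OF bounded_linear_Re this]
  show ?thesis unfolding has_field_derivative_def
    by (rule has_derivative_eq_rhs) (simp add: fun_eq_iff algebra_simps)
qed

lemma pderiv_Re_wirtinger:
  assumes "has_wirtinger_deriv f A B z"
  shows "pderiv_u (\<lambda>w. Re (f w)) z = Re (A + B)"
    and "pderiv_v (\<lambda>w. Re (f w)) z = Re (\<i> * (A - B))"
  unfolding pderiv_u_def pderiv_v_def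
  using DERIV_imp_deriv[OF Re_wirtinger_u[OF assms]] DERIV_imp_deriv[OF Re_wirtinger_v[OF assms]]
  by simp_all

text \<open>The partial derivatives of \<open>f\<close> at a point of an open set depend only on \<open>f\<close> on that set; this
  is needed because formulas for derivatives hold only on the domain.\<close>

lemma eventually_on_lines:
  assumes "open D" "z \<in> D"
  shows "\<forall>\<^sub>F u in nhds (Re z). Complex u (Im z) \<in> D"
    and "\<forall>\<^sub>F v in nhds (Im z). Complex (Re z) v \<in> D"
proof -
  have "isCont (\<lambda>u. Complex u (Im z)) (Re z)" "isCont (\<lambda>v. Complex (Re z) v) (Im z)"
    unfolding Complex_eq by (auto intro!: continuous_intros)
  then show "\<forall>\<^sub>F u in nhds (Re z). Complex u (Im z) \<in> D" "\<forall>\<^sub>F v in nhds (Im z). Complex (Re z) v \<in> D"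
    using assms by (auto simp: isCont_def tendsto_def eventually_nhds_conv_at)
qed

lemma pderiv_cong:
  assumes "open D" "z \<in> D" "\<And>w. w \<in> D \<Longrightarrow> f w = g w"
  shows "pderiv_u f z = pderiv_u g z" "pderiv_v f z = pderiv_v g z"
  unfolding pderiv_u_def pderiv_v_def
  by (rule deriv_cong_ev; use eventually_on_lines[OF assms(1,2)] in \<open>force elim: eventually_mono intro: assms(3)\<close>)+

lemma laplacian_cong:
  assumes "open D" "z \<in> D" "\<And>w. w \<in> D \<Longrightarrow> f w = g w"
  shows "laplacian f z = laplacian g z"
proof -
  have "pderiv_u (pderiv_u f) z = pderiv_u (pderiv_u g) z"
    by (rule pderiv_cong(1)[OF assms(1,2)]) (rule pderiv_cong(1)[OF assms(1) _ assms(3)])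
  moreover have "pderiv_v (pderiv_v f) z = pderiv_v (pderiv_v g) z"
    by (rule pderiv_cong(2)[OF assms(1,2)]) (rule pderiv_cong(2)[OF assms(1) _ assms(3)])
  ultimately show ?thesis by (simp add: laplacian_def)
qed

lemma Ck_on_cong:
  assumes "open D" "\<And>w. w \<in> D \<Longrightarrow> f w = g w" "Ck_on k D f"
  shows "Ck_on k D g"
  using assms(2,3)
proof (induction k arbitrary: f g)
  case 0
  then show ?case using continuous_on_cong by fastforce
next
  case (Suc k)
  have "continuous_on D g" using Suc.prems continuous_on_cong by fastforce
  moreover have "(\<lambda>u. g (Complex u (Im z))) differentiable (at (Re z))"
       "(\<lambda>v. g (Complex (Re z) v)) differentiable (at (Im z))" if z: "z \<in> D" for z
  proof -
    have "\<forall>\<^sub>F u in nhds (Re z). g (Complex u (Im z)) = f (Complex u (Im z))"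
       "\<forall>\<^sub>F v in nhds (Im z). g (Complex (Re z) v) = f (Complex (Re z) v)"
      using eventually_on_lines[OF assms(1) z] by (force elim: eventually_mono simp: Suc.prems(1))+
    then show "(\<lambda>u. g (Complex u (Im z))) differentiable (at (Re z))"
       "(\<lambda>v. g (Complex (Re z) v)) differentiable (at (Im z))"
      using Suc.prems(2) z by (auto simp: real_differentiable_def DERIV_cong_ev)
  qed
  moreover have "Ck_on k D (pderiv_u g)" "Ck_on k D (pderiv_v g)"
    using Suc.IH[OF pderiv_cong(1)[OF assms(1) _ Suc.prems(1)]] Suc.IH[OF pderiv_cong(2)[OF assms(1) _ Suc.prems(1)]]
      Suc.prems(2) by auto
  ultimately show ?case by simp
qed

lemma Ck_on_Re:
  assumes "open D" "wirtinger_Ck k D f"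
  shows "Ck_on k D (\<lambda>z. Re (f z))"
  using assms(2)
proof (induction k arbitrary: f)
  case 0
  then show ?case by (auto intro: continuous_intros)
next
  case (Suc k)
  then obtain A B where W: "\<And>z. z \<in> D \<Longrightarrow> has_wirtinger_deriv f (A z) (B z) z"
    and AB: "wirtinger_Ck k D A" "wirtinger_Ck k D B" by (auto elim: wirtinger_Ck_SucE)
  have "wirtinger_Ck k D (\<lambda>z. A z + B z)" "wirtinger_Ck k D (\<lambda>z. \<i> * (A z + (-1) * B z))"
    by (intro wirtinger_Ck_add wirtinger_Ck_mult wirtinger_Ck_const AB)+
  then have "Ck_on k D (\<lambda>z. Re (A z + B z))" "Ck_on k D (\<lambda>z. Re (\<i> * (A z - B z)))"
    using Suc.IH by fastforce+
  then have "Ck_on k D (pderiv_u (\<lambda>z. Re (f z)))" "Ck_on k D (pderiv_v (\<lambda>z. Re (f z)))"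
    by - (rule Ck_on_cong[OF assms(1), rotated], assumption, simp only: pderiv_Re_wirtinger[OF W])+
  moreover have "continuous_on D (\<lambda>z. Re (f z))"
    using wirtinger_continuous[OF W] by (auto intro: continuous_intros)
  ultimately show ?case
    using Re_wirtinger_u[OF W] Re_wirtinger_v[OF W] by (auto simp: real_differentiable_def)
qed

text \<open>\<open>\<Delta> = 4 \<partial> \<partial>'\<close>. The two mixed derivatives \<open>A\<^sub>b\<close> and \<open>B\<^sub>z\<close> are kept apart, which avoids
  proving their symmetry; the pure second derivatives cancel.\<close>

lemma laplacian_Re_wirtinger:
  assumes "open U" "z \<in> U" "\<And>w. w \<in> U \<Longrightarrow> has_wirtinger_deriv f (A w) (B w) w"
    and "has_wirtinger_deriv A A\<^sub>z A\<^sub>b z" "has_wirtinger_deriv B B\<^sub>z B\<^sub>b z"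
  shows "laplacian (\<lambda>w. Re (f w)) z = 2 * Re (A\<^sub>b + B\<^sub>z)"
proof -
  have u: "has_wirtinger_deriv (\<lambda>w. A w + B w) (A\<^sub>z + B\<^sub>z) (A\<^sub>b + B\<^sub>b) z"
    by (rule wirtinger_add[OF assms(4,5)])
  have v: "has_wirtinger_deriv (\<lambda>w. \<i> * (A w + (-1) * B w)) (\<i> * (A\<^sub>z - B\<^sub>z)) (\<i> * (A\<^sub>b - B\<^sub>b)) z"
    using wirtinger_mult[OF wirtinger_const[of \<i>]
        wirtinger_add[OF assms(4) wirtinger_mult[OF wirtinger_const[of "-1"] assms(5)]]]
    by simp
  have "pderiv_u (pderiv_u (\<lambda>w. Re (f w))) z = pderiv_u (\<lambda>w. Re (A w + B w)) z"
    by (rule pderiv_cong[OF assms(1,2)]) (simp add: pderiv_Re_wirtinger[OF assms(3)])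
  moreover have "pderiv_v (pderiv_v (\<lambda>w. Re (f w))) z = pderiv_v (\<lambda>w. Re (\<i> * (A w + (-1) * B w))) z"
    by (rule pderiv_cong[OF assms(1,2)]) (simp add: pderiv_Re_wirtinger[OF assms(3)])
  ultimately show ?thesis
    unfolding laplacian_def pderiv_Re_wirtinger[OF u] pderiv_Re_wirtinger[OF v] by simp
qed

section \<open>The logarithm of alpha and the system\<close>

text \<open>The derivatives are given as \<open>\<alpha>\<close> times the logarithmic derivatives, the form needed
  for \<open>log \<alpha>\<close>.\<close>

lemma alpha_wirtinger:
  assumes "open D" "g1 holomorphic_on D" "g2 holomorphic_on D" "z \<in> D"
    and "deriv g1 z * deriv g2 z \<noteq> 0" "g1 z * cnj (g2 z) \<noteq> - 1"
  shows "has_wirtinger_deriv (alpha g1 g2)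
    (alpha g1 g2 z * (deriv (deriv g1) z * inverse (deriv g1 z) +
      (-2) * (deriv g1 z * cnj (g2 z) * inverse (1 + g1 z * cnj (g2 z)))))
    (alpha g1 g2 z * (cnj (deriv (deriv g2) z * inverse (deriv g2 z)) +
      (-2) * (g1 z * cnj (deriv g2 z) * inverse (1 + g1 z * cnj (g2 z))))) z"
proof -
  have nz: "1 + g1 z * cnj (g2 z) \<noteq> 0" using assms(6) by (metis add.commute add_eq_0_iff)
  note hol = assms(2,3)[THEN holomorphic_deriv[OF _ assms(1)]]
  note d1 = wirtinger_holomorphic[OF hol(1) assms(1,4)]
    and d2 = wirtinger_cnj[OF wirtinger_holomorphic[OF hol(2) assms(1,4)]]
  have d3: "has_wirtinger_deriv (\<lambda>w. 1 + g1 w * cnj (g2 w)) (deriv g1 z * cnj (g2 z)) (g1 z * cnj (deriv g2 z)) z"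
    using wirtinger_add[OF wirtinger_const[of 1] wirtinger_mult[OF
      wirtinger_holomorphic[OF assms(2,1,4)] wirtinger_cnj[OF wirtinger_holomorphic[OF assms(3,1,4)]]]]
    by simp
  note d4 = wirtinger_mult[OF wirtinger_mult[OF wirtinger_mult[OF wirtinger_const[of "-4"] d1] d2]
     wirtinger_mult[OF wirtinger_inverse[OF d3 nz] wirtinger_inverse[OF d3 nz]]]
  have *: "alpha g1 g2 = (\<lambda>z. - 4 * deriv g1 z * cnj (deriv g2 z) *
      (inverse (1 + g1 z * cnj (g2 z)) * inverse (1 + g1 z * cnj (g2 z))))"
    by (simp add: alpha_def fun_eq_iff power2_eq_square divide_inverse)
  define q where "q = inverse (1 + g1 z * cnj (g2 z))"
  show ?thesis
    unfolding * q_def[symmetric]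
    by (rule wirtinger_eq_rhs[OF d4[unfolded q_def[symmetric]]])
       (use assms(5) in \<open>auto simp: field_simps\<close>)
qed

lemma alpha_nonzero:
  assumes "deriv g1 z * deriv g2 z \<noteq> 0" "g1 z * cnj (g2 z) \<noteq> - 1"
  shows "alpha g1 g2 z \<noteq> 0"
  using assms by (auto simp: alpha_def add_eq_0_iff)

lemma wirtinger_Ck_alpha:
  assumes "open D" "g1 holomorphic_on D" "g2 holomorphic_on D"
    and "\<And>z. z \<in> D \<Longrightarrow> g1 z * cnj (g2 z) \<noteq> - 1"
  shows "wirtinger_Ck k D (alpha g1 g2)"
proof -
  note hol = assms(2,3)[THEN holomorphic_deriv[OF _ assms(1)]]
  have nz: "1 + g1 z * cnj (g2 z) \<noteq> 0" if "z \<in> D" for z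
    using assms(4)[OF that] by (metis add.commute add_eq_0_iff)
  have *: "alpha g1 g2 = (\<lambda>z. - 4 * deriv g1 z * cnj (deriv g2 z) *
      (inverse (1 + g1 z * cnj (g2 z)) * inverse (1 + g1 z * cnj (g2 z))))"
    by (simp add: alpha_def fun_eq_iff power2_eq_square divide_inverse)
  show ?thesis unfolding *
    by (intro wirtinger_Ck_mult wirtinger_Ck_const wirtinger_Ck_cnj wirtinger_Ck_inverse wirtinger_Ck_add
      wirtinger_Ck_holomorphic[OF assms(1)] hol assms(2,3) nz)
qed

text \<open>The content of the system in one place. The holomorphic and antiholomorphic summands of
  \<open>\<partial> log \<alpha>\<close> and \<open>\<partial>' log \<alpha>\<close> do not contribute to the mixed second derivatives, and the remaining
  term \<open>- 2 log (1 + g1 cnj g2)\<close> contributes \<open>\<alpha> / 2\<close>.\<close>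

lemma log_alpha_branch:
  assumes "open D" "g1 holomorphic_on D" "g2 holomorphic_on D" "z0 \<in> D"
    and nz: "\<And>z. z \<in> D \<Longrightarrow> deriv g1 z * deriv g2 z \<noteq> 0"
    and den: "\<And>z. z \<in> D \<Longrightarrow> g1 z * cnj (g2 z) \<noteq> - 1"
  obtains U f where "open U" "z0 \<in> U" "U \<subseteq> D" "\<And>z. z \<in> U \<Longrightarrow> exp (f z) = alpha g1 g2 z"
    "\<And>k. wirtinger_Ck k U f"
    "\<And>z. z \<in> U \<Longrightarrow> laplacian (\<lambda>w. Re (f w)) z = 2 * Re (alpha g1 g2 z)"
    "\<And>z. z \<in> U \<Longrightarrow> laplacian (\<lambda>w. Im (f w)) z = 2 * Im (alpha g1 g2 z)"
proof -
  define \<alpha> where "\<alpha> = alpha g1 g2"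
  define P where "P = (\<lambda>z. deriv (deriv g1) z * inverse (deriv g1 z) +
      (-2) * (deriv g1 z * cnj (g2 z) * inverse (1 + g1 z * cnj (g2 z))))"
  define Q where "Q = (\<lambda>z. cnj (deriv (deriv g2) z * inverse (deriv g2 z)) +
      (-2) * (g1 z * cnj (deriv g2 z) * inverse (1 + g1 z * cnj (g2 z))))"
  have \<alpha>0: "\<alpha> z \<noteq> 0" if "z \<in> D" for z
    unfolding \<alpha>_def using alpha_nonzero nz den that by blast
  have d\<alpha>: "has_wirtinger_deriv \<alpha> (\<alpha> z * P z) (\<alpha> z * Q z) z" if "z \<in> D" for z
    unfolding \<alpha>_def P_def Q_def using alpha_wirtinger assms that by blast
  \<comment> \<open>Dividing by the value at \<open>z0\<close> keeps the argument of \<^const>\<open>Ln\<close> in the right half plane,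
    away from the branch cut.\<close>
  define U where "U = {z \<in> D. 0 < Re (\<alpha> z / \<alpha> z0)}"
  define f where "f = (\<lambda>z. Ln (\<alpha> z / \<alpha> z0) + Ln (\<alpha> z0))"
  have "continuous_on D \<alpha>"
    using wirtinger_Ck_alpha[OF assms(1-3) den, of 0] by (simp add: \<alpha>_def)
  then have cont: "continuous_on D (\<lambda>z. Re (\<alpha> z / \<alpha> z0))"
    using \<alpha>0[OF assms(4)] by (intro continuous_intros) auto
  have U: "open U"
    using continuous_open_preimage[OF cont assms(1) open_greaterThan[of 0]]
    by (simp add: U_def vimage_def Int_def)
  have UD: "U \<subseteq> D" by (auto simp: U_def)
  have df: "has_wirtinger_deriv f (P z) (Q z) z" if z: "z \<in> U" for z
  proof -
    have pos: "0 < Re (\<alpha> z / \<alpha> z0)" and zD: "z \<in> D" using z by (auto simp: U_def)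
    then have "\<alpha> z / \<alpha> z0 \<notin> \<real>\<^sub>\<le>\<^sub>0" by (meson complex_nonpos_Reals_iff not_le)
    then have "((\<lambda>w. Ln (w / \<alpha> z0) + Ln (\<alpha> z0)) has_field_derivative 1 / \<alpha> z) (at (\<alpha> z))"
      using \<alpha>0[OF zD] \<alpha>0[OF assms(4)] by (auto intro!: derivative_eq_intros simp: field_simps)
    from wirtinger_chain[OF d\<alpha>[OF zD] this] show ?thesis
      using \<alpha>0[OF zD] by (simp add: f_def)
  qed
  note hol = assms(2,3)[THEN holomorphic_on_subset[OF _ UD]]
  note dhol = hol[THEN holomorphic_deriv[OF _ U]]
  have nz': "deriv g1 z \<noteq> 0" "deriv g2 z \<noteq> 0" "1 + g1 z * cnj (g2 z) \<noteq> 0" if "z \<in> U" for z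
    using nz[of z] den[of z] that UD by (auto simp: add_eq_0_iff)
  have Ck: "wirtinger_Ck k U f" for k
  proof -
    have "wirtinger_Ck k U P" "wirtinger_Ck k U Q"
      unfolding P_def Q_def
      by (intro wirtinger_Ck_mult wirtinger_Ck_const wirtinger_Ck_cnj wirtinger_Ck_inverse wirtinger_Ck_add
        wirtinger_Ck_holomorphic[OF U] dhol[THEN holomorphic_deriv[OF _ U]] dhol hol nz'; assumption)+
    then show ?thesis using wirtinger_Ck_SucI[OF df] wirtinger_Ck_Suc_imp by blast
  qed
  have lap: "\<exists>P\<^sub>z Q\<^sub>b. has_wirtinger_deriv P P\<^sub>z (\<alpha> z / 2) z \<and> has_wirtinger_deriv Q (\<alpha> z / 2) Q\<^sub>b z"
    if z: "z \<in> U" for z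
  proof -
    let ?q = "1 + g1 z * cnj (g2 z)"
    have h1: "(\<lambda>z. deriv (deriv g1) z * inverse (deriv g1 z)) holomorphic_on U"
      and h2: "(\<lambda>z. deriv (deriv g2) z * inverse (deriv g2 z)) holomorphic_on U"
      using nz' by (auto intro!: holomorphic_intros dhol[THEN holomorphic_deriv[OF _ U]] dhol)
    have d3: "has_wirtinger_deriv (\<lambda>w. 1 + g1 w * cnj (g2 w)) (deriv g1 z * cnj (g2 z)) (g1 z * cnj (deriv g2 z)) z"
      using wirtinger_add[OF wirtinger_const[of 1] wirtinger_mult[OF
        wirtinger_holomorphic[OF hol(1) U z] wirtinger_cnj[OF wirtinger_holomorphic[OF hol(2) U z]]]]
      by simp
    note inv = wirtinger_inverse[OF d3 nz'(3)[OF z]]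
    note hg = wirtinger_holomorphic[OF hol(1) U z] wirtinger_cnj[OF wirtinger_holomorphic[OF hol(2) U z]]
      wirtinger_holomorphic[OF dhol(1) U z] wirtinger_cnj[OF wirtinger_holomorphic[OF dhol(2) U z]]
    note dP = wirtinger_add[OF wirtinger_holomorphic[OF h1 U z]
      wirtinger_mult[OF wirtinger_const[of "-2"]
       wirtinger_mult[OF wirtinger_mult[OF hg(3,2)] inv]]]
    note dQ = wirtinger_add[OF wirtinger_cnj[OF wirtinger_holomorphic[OF h2 U z]]
      wirtinger_mult[OF wirtinger_const[of "-2"]
       wirtinger_mult[OF wirtinger_mult[OF hg(1,4)] inv]]]
    have "\<alpha> z / 2 = -2 * deriv g1 z * cnj (deriv g2 z) / ?q\<^sup>2" by (simp add: \<alpha>_def alpha_def)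
    also have "\<dots> = -2 * (deriv g1 z * cnj (deriv g2 z) * inverse ?q
        + deriv g1 z * cnj (g2 z) * (- (g1 z * cnj (deriv g2 z)) * inverse ?q * inverse ?q))"
      using nz'(3)[OF z] by (simp add: divide_simps) (simp add: algebra_simps power2_eq_square)
    finally have a: "\<alpha> z / 2 = \<dots>" .
    show ?thesis unfolding P_def Q_def
      by (intro exI conjI; rule wirtinger_eq_rhs[OF dP refl] wirtinger_eq_rhs[OF dQ _ refl])
       (simp_all add: a algebra_simps)
  qed
  have "laplacian (\<lambda>w. Re (f w)) z = 2 * Re (\<alpha> z)" if z: "z \<in> U" for z
    using lap[OF z] laplacian_Re_wirtinger[OF U z df] by fastforce
  moreover have "laplacian (\<lambda>w. Im (f w)) z = 2 * Im (\<alpha> z)" if z: "z \<in> U" for z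
  proof -
    have df': "has_wirtinger_deriv (\<lambda>w. - \<i> * f w) (- \<i> * P w) (- \<i> * Q w) w" if "w \<in> U" for w
      using wirtinger_mult[OF wirtinger_const[of "- \<i>"] df[OF that]] by simp
    obtain P\<^sub>z Q\<^sub>b where PQ: "has_wirtinger_deriv P P\<^sub>z (\<alpha> z / 2) z" "has_wirtinger_deriv Q (\<alpha> z / 2) Q\<^sub>b z"
      using lap[OF z] by blast
    have "laplacian (\<lambda>w. Re (- \<i> * f w)) z = 2 * Re (- \<i> * (\<alpha> z / 2) + - \<i> * (\<alpha> z / 2))"
      using wirtinger_mult[OF wirtinger_const[of "- \<i>"] PQ(1)] wirtinger_mult[OF wirtinger_const[of "- \<i>"] PQ(2)]
      by (intro laplacian_Re_wirtinger[OF U z df']) simp_all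
    then show ?thesis by simp
  qed
  moreover have "exp (f z) = \<alpha> z" if "z \<in> U" for z
    using \<alpha>0[of z] \<alpha>0[OF assms(4)] that UD by (auto simp: f_def exp_add)
  moreover have "z0 \<in> U" using assms(4) \<alpha>0[OF assms(4)] by (simp add: U_def)
  ultimately show thesis using that[of U f] U UD Ck unfolding \<alpha>_def by blast
qed

lemma smooth_on_Re: "open D \<Longrightarrow> (\<And>k. wirtinger_Ck k D f) \<Longrightarrow> smooth_on D (\<lambda>z. Re (f z))"
  by (simp add: smooth_on_def Ck_on_Re)

lemma smooth_on_Im:
  assumes "open D" "\<And>k. wirtinger_Ck k D f"
  shows "smooth_on D (\<lambda>z. Im (f z))"
  using smooth_on_Re[OF assms(1) wirtinger_Ck_mult[OF wirtinger_Ck_const[of _ _ "-\<i>"] assms(2)]] by simp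

lemma sum_squares_cmod_mult:
  "(cmod \<alpha> * Re \<alpha>)\<^sup>2 + (cmod \<alpha> * Im \<alpha>)\<^sup>2 = cmod \<alpha> ^ 4"
proof -
  have "(cmod \<alpha> * Re \<alpha>)\<^sup>2 + (cmod \<alpha> * Im \<alpha>)\<^sup>2 = (cmod \<alpha>)\<^sup>2 * ((Re \<alpha>)\<^sup>2 + (Im \<alpha>)\<^sup>2)"
    by (simp add: power_mult_distrib distrib_left)
  also have "(Re \<alpha>)\<^sup>2 + (Im \<alpha>)\<^sup>2 = (cmod \<alpha>)\<^sup>2" by (simp add: cmod_power2)
  finally show ?thesis by (simp flip: power_add)
qed

text \<open>With \<open>|\<alpha>| = e\<^sup>X\<close>, the factor \<open>(K\<^sup>2 + \<kappa>\<^sup>2) powr (1/4)\<close> is \<open>|\<alpha>|\<close>; dividing it out leaves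
  \<open>\<Delta> X = 2 Re \<alpha>\<close> and \<open>\<Delta> Y = 2 Im \<alpha>\<close>.\<close>

lemma generated_solution:
  assumes "open D" "g1 holomorphic_on D" "g2 holomorphic_on D"
    and nz: "\<And>z. z \<in> D \<Longrightarrow> deriv g1 z * deriv g2 z \<noteq> 0"
    and den: "\<And>z. z \<in> D \<Longrightarrow> g1 z * cnj (g2 z) \<noteq> - 1"
  shows "solution_on D (\<lambda>z. cmod (alpha g1 g2 z) * Re (alpha g1 g2 z))
                       (\<lambda>z. cmod (alpha g1 g2 z) * Im (alpha g1 g2 z))"
proof -
  define \<alpha> where "\<alpha> = alpha g1 g2"
  have \<alpha>0: "\<alpha> z \<noteq> 0" if "z \<in> D" for z
    unfolding \<alpha>_def using alpha_nonzero nz den that by blast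
  have "wirtinger_Ck k D (\<lambda>z. of_real (cmod (\<alpha> z)) * \<alpha> z)" for k
    using wirtinger_Ck_alpha[OF assms(1-3) den] \<alpha>0
    by (intro wirtinger_Ck_mult wirtinger_Ck_cmod) (auto simp: \<alpha>_def)
  from smooth_on_Re[OF assms(1) this] smooth_on_Im[OF assms(1) this]
  have smooth: "smooth_on D (\<lambda>z. cmod (\<alpha> z) * Re (\<alpha> z))" "smooth_on D (\<lambda>z. cmod (\<alpha> z) * Im (\<alpha> z))"
    by simp_all
  have root: "(cmod a ^ 4) powr (1/4) = cmod a" if "a \<noteq> 0" for a :: complex
  proof -
    have "cmod a ^ 4 = cmod a powr 4" using that by (simp add: powr_numeral)
    then show ?thesis using that by (simp only: powr_powr) simp
  qed
  have sqrt4: "sqrt (cmod a ^ 4) = (cmod a)\<^sup>2" for a :: complex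
    by (rule real_sqrt_unique) (simp_all flip: power_mult)
  have *: "cmod (\<alpha> z) * laplacian (\<lambda>w. ln ((cmod (\<alpha> w) ^ 4) powr (1/4))) z = 2 * (cmod (\<alpha> z) * Re (\<alpha> z)) \<and>
     (\<exists>U Y. open U \<and> z \<in> U \<and> U \<subseteq> D \<and>
        arg_branch_on U (\<lambda>z. cmod (\<alpha> z) * Re (\<alpha> z)) (\<lambda>z. cmod (\<alpha> z) * Im (\<alpha> z)) Y \<and>
        (\<forall>w\<in>U. cmod (\<alpha> w) * laplacian Y w = 2 * (cmod (\<alpha> w) * Im (\<alpha> w))))" if z: "z \<in> D" for z
  proof -
    obtain U f where U: "open U" "z \<in> U" "U \<subseteq> D" and f: "\<And>z. z \<in> U \<Longrightarrow> exp (f z) = alpha g1 g2 z"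
      and Ck: "\<And>k. wirtinger_Ck k U f"
      and lapR: "\<And>z. z \<in> U \<Longrightarrow> laplacian (\<lambda>w. Re (f w)) z = 2 * Re (alpha g1 g2 z)"
      and lapI: "\<And>z. z \<in> U \<Longrightarrow> laplacian (\<lambda>w. Im (f w)) z = 2 * Im (alpha g1 g2 z)"
      by (rule log_alpha_branch[OF assms(1-3) z nz den]) blast+
    have cm: "cmod (\<alpha> w) = exp (Re (f w))" if "w \<in> U" for w
      using f[OF that, symmetric] by (simp add: \<alpha>_def)
    have "laplacian (\<lambda>w. ln ((cmod (\<alpha> w) ^ 4) powr (1/4))) z = laplacian (\<lambda>w. Re (f w)) z"
    proof (rule laplacian_cong[OF U(1,2)])
      fix w assume w: "w \<in> U"
      then have "\<alpha> w \<noteq> 0" using U(3) \<alpha>0 by blast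
      then show "ln ((cmod (\<alpha> w) ^ 4) powr (1/4)) = Re (f w)" by (simp add: root) (simp add: cm[OF w])
    qed
    moreover have "arg_branch_on U (\<lambda>z. cmod (\<alpha> z) * Re (\<alpha> z)) (\<lambda>z. cmod (\<alpha> z) * Im (\<alpha> z)) (\<lambda>w. Im (f w))"
      unfolding arg_branch_on_def sum_squares_cmod_mult sqrt4
    proof (intro conjI ballI)
      fix w assume w: "w \<in> U"
      have "Re (\<alpha> w) = cmod (\<alpha> w) * cos (Im (f w))" "Im (\<alpha> w) = cmod (\<alpha> w) * sin (Im (f w))"
        unfolding cm[OF w] using f[OF w, symmetric] by (simp_all add: \<alpha>_def Re_exp Im_exp)
      then show "cmod (\<alpha> w) * Re (\<alpha> w) = (cmod (\<alpha> w))\<^sup>2 * cos (Im (f w))"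
        "cmod (\<alpha> w) * Im (\<alpha> w) = (cmod (\<alpha> w))\<^sup>2 * sin (Im (f w))"
        by (simp_all add: power2_eq_square)
    qed (use smooth_on_Im[OF U(1) Ck] in auto)
    ultimately show ?thesis
      using U lapR[OF U(2)] lapI unfolding \<alpha>_def by (intro conjI exI[of _ U] exI[of _ "\<lambda>w. Im (f w)"]) auto
  qed
  show ?thesis
    unfolding solution_on_def sum_squares_cmod_mult \<alpha>_def[symmetric]
  proof (intro conjI ballI smooth)
    fix z assume z: "z \<in> D"
    show "cmod (\<alpha> z) ^ 4 \<noteq> 0" using \<alpha>0[OF z] by simp
    show "(cmod (\<alpha> z) ^ 4) powr (1/4) * laplacian (\<lambda>w. ln ((cmod (\<alpha> w) ^ 4) powr (1/4))) z
        = 2 * (cmod (\<alpha> z) * Re (\<alpha> z))"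
      using *[OF z] unfolding root[OF \<alpha>0[OF z]] by blast
    obtain U Y where "open U" "z \<in> U" "U \<subseteq> D"
        "arg_branch_on U (\<lambda>z. cmod (\<alpha> z) * Re (\<alpha> z)) (\<lambda>z. cmod (\<alpha> z) * Im (\<alpha> z)) Y"
        "\<forall>w\<in>U. cmod (\<alpha> w) * laplacian Y w = 2 * (cmod (\<alpha> w) * Im (\<alpha> w))"
      using *[OF z] by blast
    moreover from this have "\<forall>w\<in>U. (cmod (\<alpha> w) ^ 4) powr (1/4) * laplacian Y w = 2 * (cmod (\<alpha> w) * Im (\<alpha> w))"
      by (metis root \<alpha>0 subsetD)
    ultimately show "\<exists>U Y. open U \<and> z \<in> U \<and> U \<subseteq> D \<and>
        arg_branch_on U (\<lambda>z. cmod (\<alpha> z) * Re (\<alpha> z)) (\<lambda>z. cmod (\<alpha> z) * Im (\<alpha> z)) Y \<and>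
        (\<forall>w\<in>U. (cmod (\<alpha> w) ^ 4) powr (1/4) * laplacian Y w = 2 * (cmod (\<alpha> w) * Im (\<alpha> w)))"
      by blast
  qed
qed

text \<open>The map \<open>\<alpha> \<mapsto> |\<alpha>| \<alpha>\<close> is injective, since its modulus is \<open>|\<alpha>|\<^sup>2\<close>.\<close>

lemma alpha_eq_of_generates_same:
  assumes "generates_on D g1 g2 K \<kappa>" "generates_on D h1 h2 K \<kappa>" "z \<in> D"
  shows "alpha g1 g2 z = alpha h1 h2 z"
proof -
  define a where "a = alpha g1 g2 z"
  define b where "b = alpha h1 h2 z"
  have eq: "of_real (cmod a) * a = of_real (cmod b) * b"
    using assms by (auto simp: generates_on_def a_def b_def complex_eq_iff)
  then have "cmod a * cmod a = cmod b * cmod b" by (metis norm_mult norm_of_real abs_norm_cancel)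
  then have "cmod a = cmod b" by (metis norm_ge_zero power2_eq_imp_eq power2_eq_square)
  with eq have "a = b" by (cases "cmod b = 0") auto
  then show ?thesis by (simp add: a_def b_def)
qed

section \<open>Separation of the holomorphic and antiholomorphic variable\<close>

text \<open>Lists of pairs represent finite sums \<open>\<Sum> p\<^sub>i cnj q\<^sub>i\<close>; the derivative \<open>\<partial>\<close> acts only on the
  first entries.\<close>

lemma pairing_wirtinger:
  assumes "open D" "z \<in> D"
    and "\<And>p q. (p, q) \<in> set ps \<Longrightarrow> p holomorphic_on D \<and> q holomorphic_on D"
  shows "has_wirtinger_deriv (\<lambda>z. \<Sum>(p, q)\<leftarrow>ps. p z * cnj (q z))
    (\<Sum>(p, q)\<leftarrow>ps. deriv p z * cnj (q z)) (\<Sum>(p, q)\<leftarrow>ps. p z * cnj (deriv q z)) z"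
  using assms(3)
proof (induction ps)
  case Nil
  then show ?case by (simp add: wirtinger_const)
next
  case (Cons r ps)
  obtain p q where r: "r = (p, q)" by fastforce
  have pq: "p holomorphic_on D" "q holomorphic_on D" using Cons.prems[of p q] r by auto
  have "has_wirtinger_deriv (\<lambda>z. p z * cnj (q z)) (deriv p z * cnj (q z)) (p z * cnj (deriv q z)) z"
    using wirtinger_mult[OF wirtinger_holomorphic[OF pq(1) assms(1,2)]
        wirtinger_cnj[OF wirtinger_holomorphic[OF pq(2) assms(1,2)]]] by simp
  from wirtinger_add[OF this Cons.IH[OF Cons.prems]] r show ?case by simp
qed

lemma higher_deriv_pairing:
  assumes "open D" "z \<in> D" "\<And>p q. (p, q) \<in> set ps \<Longrightarrow> p holomorphic_on D"
  shows "(deriv ^^ n) (\<lambda>z. \<Sum>(p, q)\<leftarrow>ps. p z * cnj (q w)) z =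
    (\<Sum>(p, q)\<leftarrow>ps. (deriv ^^ n) p z * cnj (q w))
    \<and> (\<lambda>z. \<Sum>(p, q)\<leftarrow>ps. p z * cnj (q w)) holomorphic_on D"
  using assms(3)
proof (induction ps)
  case Nil
  have "(deriv ^^ n) (\<lambda>z. 0 * (0::complex)) z = 0"
    by (subst higher_deriv_cmult[of _ UNIV]) auto
  then show ?case by simp
next
  case (Cons r ps)
  obtain p q where r: "r = (p, q)" by fastforce
  have p: "p holomorphic_on D" using Cons.prems[of p q] r by auto
  define S where "S = (\<lambda>z. \<Sum>(p, q)\<leftarrow>ps. p z * cnj (q w))"
  have IH: "(deriv ^^ n) S z = (\<Sum>(p, q)\<leftarrow>ps. (deriv ^^ n) p z * cnj (q w))" "S holomorphic_on D"
    using Cons unfolding S_def by auto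
  have p': "(\<lambda>z. cnj (q w) * p z) holomorphic_on D" using p by (intro holomorphic_intros)
  have "(deriv ^^ n) (\<lambda>z. cnj (q w) * p z + S z) z = cnj (q w) * (deriv ^^ n) p z + (deriv ^^ n) S z"
    using higher_deriv_add[OF p' IH(2) assms(1,2)] higher_deriv_cmult[OF p assms(2,1)] by simp
  moreover have "(\<lambda>z. cnj (q w) * p z + S z) holomorphic_on D" by (intro holomorphic_intros p' IH p)
  ultimately show ?case using IH(1) r by (simp add: S_def mult.commute)
qed

text \<open>Differentiating with respect to \<open>z\<close> alone keeps the sum zero on the diagonal, so for fixed
  \<open>w\<close> the holomorphic function \<open>z \<mapsto> \<Sum> p\<^sub>i(z) cnj q\<^sub>i(w)\<close> has all derivatives zero at \<open>z = w\<close> and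
  vanishes on the connected set \<open>D\<close>.\<close>

lemma polarization:
  assumes "open D" "connected D"
    and hol: "\<And>p q. (p, q) \<in> set ps \<Longrightarrow> p holomorphic_on D \<and> q holomorphic_on D"
    and zero: "\<And>z. z \<in> D \<Longrightarrow> (\<Sum>(p, q)\<leftarrow>ps. p z * cnj (q z)) = 0"
    and "z \<in> D" "w \<in> D"
  shows "(\<Sum>(p, q)\<leftarrow>ps. p z * cnj (q w)) = 0"
proof -
  have all: "\<forall>z\<in>D. (\<Sum>(p, q)\<leftarrow>ps. (deriv ^^ n) p z * cnj (q z)) = 0" for n
  proof (induction n)
    case 0
    then show ?case using zero by simp
  next
    case (Suc n)
    let ?ps = "map (\<lambda>(p, q). ((deriv ^^ n) p, q)) ps"
    show ?case
    proof
      fix z assume z: "z \<in> D"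
      have "has_wirtinger_deriv (\<lambda>z. \<Sum>(p, q)\<leftarrow>?ps. p z * cnj (q z))
        (\<Sum>(p, q)\<leftarrow>?ps. deriv p z * cnj (q z)) (\<Sum>(p, q)\<leftarrow>?ps. p z * cnj (deriv q z)) z"
        using hol by (intro pairing_wirtinger[OF assms(1) z]) (auto intro: holomorphic_higher_deriv assms(1))
      moreover have "(\<Sum>(p, q)\<leftarrow>?ps. p z * cnj (q z)) = 0" if "z \<in> D" for z
        using Suc that by (simp add: o_def case_prod_unfold)
      ultimately have "has_wirtinger_deriv (\<lambda>_. 0) (\<Sum>(p, q)\<leftarrow>?ps. deriv p z * cnj (q z))
          (\<Sum>(p, q)\<leftarrow>?ps. p z * cnj (deriv q z)) z"
        by (rule wirtinger_cong_on[OF _ assms(1) z])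
      from wirtinger_unique_zero[OF this]
      show "(\<Sum>(p, q)\<leftarrow>ps. (deriv ^^ Suc n) p z * cnj (q z)) = 0"
        by (simp add: o_def case_prod_unfold)
    qed
  qed
  have *: "(deriv ^^ n) (\<lambda>z. \<Sum>(p, q)\<leftarrow>ps. p z * cnj (q w)) w = 0"
      "(\<lambda>z. \<Sum>(p, q)\<leftarrow>ps. p z * cnj (q w)) holomorphic_on D" for n
    using higher_deriv_pairing[OF assms(1) \<open>w \<in> D\<close>, of ps n w] hol all[of n] \<open>w \<in> D\<close> by auto
  show ?thesis
    by (rule holomorphic_fun_eq_0_on_connected[OF *(2) assms(1,2) *(1) \<open>w \<in> D\<close> \<open>z \<in> D\<close>])
qed

text \<open>The denominators of \<open>\<alpha>\<close> can vanish off the diagonal, hence the multiplied-out form.\<close>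

lemma polarized_alpha_eq:
  assumes "open D" "connected D"
    and hol: "g1 holomorphic_on D" "g2 holomorphic_on D" "h1 holomorphic_on D" "h2 holomorphic_on D"
    and g: "\<And>z. z \<in> D \<Longrightarrow> g1 z * cnj (g2 z) \<noteq> - 1"
    and h: "\<And>z. z \<in> D \<Longrightarrow> h1 z * cnj (h2 z) \<noteq> - 1"
    and eq: "\<And>z. z \<in> D \<Longrightarrow> alpha g1 g2 z = alpha h1 h2 z"
    and "z \<in> D" "w \<in> D"
  shows "deriv g1 z * cnj (deriv g2 w) * (1 + h1 z * cnj (h2 w))\<^sup>2 =
         deriv h1 z * cnj (deriv h2 w) * (1 + g1 z * cnj (g2 w))\<^sup>2"
proof -
  \<comment> \<open>The difference of the two sides with the squares expanded, as one sum of products.\<close>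
  let ?ps = "[(deriv g1, deriv g2), (\<lambda>z. 2 * deriv g1 z * h1 z, \<lambda>z. deriv g2 z * h2 z),
      (\<lambda>z. deriv g1 z * (h1 z)\<^sup>2, \<lambda>z. deriv g2 z * (h2 z)\<^sup>2),
      (\<lambda>z. - deriv h1 z, deriv h2), (\<lambda>z. - 2 * deriv h1 z * g1 z, \<lambda>z. deriv h2 z * g2 z),
      (\<lambda>z. - deriv h1 z * (g1 z)\<^sup>2, \<lambda>z. deriv h2 z * (g2 z)\<^sup>2)]"
  have expand: "(\<Sum>(p, q)\<leftarrow>?ps. p z * cnj (q w)) =
      deriv g1 z * cnj (deriv g2 w) * (1 + h1 z * cnj (h2 w))\<^sup>2
      - deriv h1 z * cnj (deriv h2 w) * (1 + g1 z * cnj (g2 w))\<^sup>2" for z w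
    by (simp add: power2_eq_square algebra_simps)
  have "(\<Sum>(p, q)\<leftarrow>?ps. p z * cnj (q w)) = 0"
  proof (rule polarization[OF assms(1,2) _ _ \<open>z \<in> D\<close> \<open>w \<in> D\<close>])
    show "p holomorphic_on D \<and> q holomorphic_on D" if "(p, q) \<in> set ?ps" for p q
      using that hol hol[THEN holomorphic_deriv[OF _ assms(1)]] by (auto intro!: holomorphic_intros)
    show "(\<Sum>(p, q)\<leftarrow>?ps. p z * cnj (q z)) = 0" if z: "z \<in> D" for z
    proof -
      have "1 + g1 z * cnj (g2 z) \<noteq> 0" "1 + h1 z * cnj (h2 z) \<noteq> 0"
        using g[OF z] h[OF z] by (auto simp: add_eq_0_iff)
      then show ?thesis unfolding expand using eq[OF z] by (simp add: alpha_def frac_eq_eq mult.assoc)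
    qed
  qed
  then show ?thesis unfolding expand by simp
qed

section \<open>Moebius transformations\<close>

lemma deriv_moebius:
  assumes "open D" "g holomorphic_on D" "z \<in> D"
    and "\<And>w. w \<in> D \<Longrightarrow> c * g w + d \<noteq> 0 \<and> h w = (a * g w + b) / (c * g w + d)"
  shows "deriv h z = (a * d - b * c) * deriv g z / (c * g z + d)\<^sup>2"
proof -
  have g: "(g has_field_derivative deriv g z) (at z)"
    using assms by (intro holomorphic_derivI)
  have nz: "c * g z + d \<noteq> 0" using assms(3,4) by blast
  have "((\<lambda>w. (a * g w + b) / (c * g w + d)) has_field_derivative
      (a * d - b * c) * deriv g z / (c * g z + d)\<^sup>2) (at z)"
    using nz by (auto intro!: derivative_eq_intros g simp: field_simps power2_eq_square)
  then have "(h has_field_derivative (a * d - b * c) * deriv g z / (c * g z + d)\<^sup>2) (at z)"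
    by (rule has_field_derivative_transform_within_open[OF _ assms(1,3)]) (use assms(4) in auto)
  then show ?thesis by (rule DERIV_imp_deriv)
qed

text \<open>Everything rests on
  \<open>(c g1 + d) (a - b G) + (a g1 + b) (d G - c) = (a d - b c) (1 + g1 G)\<close> with \<open>G = cnj g2\<close>: the
  coefficients for \<open>g2\<close> are, up to a factor, those of the inverse adjoint matrix, so the Hermitian
  pairing of \<open>(g1, 1)\<close> with \<open>(g2, 1)\<close> is preserved up to that factor and the denominators.\<close>

lemma alpha_moebius_invariant:
  assumes "open D" "g1 holomorphic_on D" "g2 holomorphic_on D" "z \<in> D" "a * d - b * c \<noteq> 0"
    and h1: "\<And>z. z \<in> D \<Longrightarrow> c * g1 z + d \<noteq> 0 \<and> h1 z = (a * g1 z + b) / (c * g1 z + d)"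
    and h2: "\<And>z. z \<in> D \<Longrightarrow> - cnj b * g2 z + cnj a \<noteq> 0 \<and>
        h2 z = (cnj d * g2 z + - cnj c) / (- cnj b * g2 z + cnj a)"
  shows "alpha h1 h2 z = alpha g1 g2 z"
proof -
  define G where "G = cnj (g2 z)"
  define \<delta> where "\<delta> = a * d - b * c"
  define m where "m = c * g1 z + d"
  define n where "n = - b * G + a"
  have "cnj n \<noteq> 0" using h2[OF assms(4)] by (simp add: n_def G_def)
  then have nz: "m \<noteq> 0" "n \<noteq> 0" "\<delta> \<noteq> 0" using h1[OF assms(4)] assms(5) by (auto simp: m_def \<delta>_def)
  have d1: "deriv h1 z = \<delta> * deriv g1 z / m\<^sup>2"
    using deriv_moebius[OF assms(1,2,4) h1] by (simp add: \<delta>_def m_def)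
  have "deriv h2 z = (cnj d * cnj a - (- cnj c) * (- cnj b)) * deriv g2 z / (- cnj b * g2 z + cnj a)\<^sup>2"
    by (rule deriv_moebius[OF assms(1,3,4) h2])
  then have d2: "cnj (deriv h2 z) = \<delta> * cnj (deriv g2 z) / n\<^sup>2"
    by (simp add: \<delta>_def n_def G_def algebra_simps)
  have H2: "cnj (h2 z) = (d * G - c) / n"
    using h2[OF assms(4)] by (simp add: n_def G_def)
  have H1: "h1 z = (a * g1 z + b) / m" using h1[OF assms(4)] by (simp add: m_def)
  have "1 + h1 z * cnj (h2 z) = (m * n + (a * g1 z + b) * (d * G - c)) / (m * n)"
    using nz by (simp add: H1 H2 field_simps)
  also have "m * n + (a * g1 z + b) * (d * G - c) = \<delta> * (1 + g1 z * G)"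
    by (simp add: m_def n_def \<delta>_def algebra_simps)
  finally have den: "1 + h1 z * cnj (h2 z) = \<delta> * (1 + g1 z * G) / (m * n)" .
  have cancel: "- 4 * (\<delta> * x / m\<^sup>2) * (\<delta> * y / n\<^sup>2) / (\<delta> * e / (m * n))\<^sup>2 = - 4 * x * y / e\<^sup>2" for x y e
    using nz by (simp add: divide_simps power2_eq_square)
  show ?thesis
    unfolding alpha_def d1 d2 den cancel G_def ..
qed

text \<open>The derivative of \<open>(g - g(w)) / (1 + p g)\<close> is \<open>(1 + p g(w)) g' / (1 + p g)\<^sup>2\<close>, so the
  hypothesis says that two such quotients have proportional derivatives near \<open>w\<close>; both vanish at
  \<open>w\<close>, so they are themselves proportional there. Without denominators the relation continues
  analytically to all of \<open>D\<close>, including zeros of \<open>1 + p g\<close> and \<open>1 + q h\<close>.\<close>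

lemma moebius_of_derivative_eq:
  fixes g h :: "complex \<Rightarrow> complex"
  assumes "open D" "connected D" "g holomorphic_on D" "h holomorphic_on D" "w \<in> D"
    and nz: "1 + p * g w \<noteq> 0" "1 + q * h w \<noteq> 0"
    and eq: "\<And>z. z \<in> D \<Longrightarrow> B * deriv h z * (1 + p * g z)\<^sup>2 = A * deriv g z * (1 + q * h z)\<^sup>2"
    and "z \<in> D"
  shows "B * (1 + p * g w) * ((h z - h w) * (1 + p * g z)) =
         A * (1 + q * h w) * ((g z - g w) * (1 + q * h z))"
proof -
  define U where "U = {z \<in> D. 1 + p * g z \<noteq> 0} \<inter> {z \<in> D. 1 + q * h z \<noteq> 0}"
  have "open U"
  proof -
    have "continuous_on D (\<lambda>z. 1 + p * g z)" "continuous_on D (\<lambda>z. 1 + q * h z)"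
      using assms(3,4)[THEN holomorphic_on_imp_continuous_on] by (auto intro!: continuous_intros)
    from this[THEN continuous_open_preimage[OF _ assms(1), of _ "- {0}"]]
    show ?thesis unfolding U_def by (intro open_Int) (auto simp: vimage_def Int_def)
  qed
  moreover have "w \<in> U" using assms by (simp add: U_def)
  ultimately obtain r where r: "r > 0" "ball w r \<subseteq> U" by (meson openE)
  define F where "F z = B * (1 + p * g w) * ((h z - h w) / (1 + q * h z)) -
         A * (1 + q * h w) * ((g z - g w) / (1 + p * g z))" for z
  have "(F has_field_derivative 0) (at z within ball w r)" if "z \<in> ball w r" for z
  proof -
    have zU: "z \<in> D" "1 + p * g z \<noteq> 0" "1 + q * h z \<noteq> 0" using that r(2) by (auto simp: U_def)
    have g: "(g has_field_derivative deriv g z) (at z)" and h: "(h has_field_derivative deriv h z) (at z)"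
      using assms zU by (auto intro!: holomorphic_derivI)
    have dg: "((\<lambda>z. (g z - g w) / (1 + p * g z)) has_field_derivative (1 + p * g w) * deriv g z / (1 + p * g z)\<^sup>2) (at z)"
      using zU(2) by (auto intro!: derivative_eq_intros g simp: field_simps power2_eq_square)
    have dh: "((\<lambda>z. (h z - h w) / (1 + q * h z)) has_field_derivative (1 + q * h w) * deriv h z / (1 + q * h z)\<^sup>2) (at z)"
      using zU(3) by (auto intro!: derivative_eq_intros h simp: field_simps power2_eq_square)
    have "B * deriv h z / (1 + q * h z)\<^sup>2 = A * deriv g z / (1 + p * g z)\<^sup>2"
      using zU eq[OF zU(1)] by (simp add: frac_eq_eq)
    moreover have "B * m * (n * x / u) - A * n * (m * y / v) = m * n * (B * x / u - A * y / v)"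
      for m n x y u v by (simp add: algebra_simps)
    ultimately have "B * (1 + p * g w) * ((1 + q * h w) * deriv h z / (1 + q * h z)\<^sup>2)
       - A * (1 + q * h w) * ((1 + p * g w) * deriv g z / (1 + p * g z)\<^sup>2) = 0"
      by simp
    with DERIV_diff[OF DERIV_cmult[OF dh, of "B * (1 + p * g w)"] DERIV_cmult[OF dg, of "A * (1 + q * h w)"]]
    have "(F has_field_derivative 0) (at z)" unfolding F_def by simp
    then show ?thesis by (rule has_field_derivative_at_within)
  qed
  then obtain k where k: "\<And>z. z \<in> ball w r \<Longrightarrow> F z = k"
    using has_field_derivative_zero_constant[of "ball w r" F] by auto
  have "k = F w" using k[of w] r(1) by simp
  then have F0: "F z = 0" if "z \<in> ball w r" for z using k[OF that] by (simp add: F_def)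
  have loc: "B * (1 + p * g w) * ((h z - h w) * (1 + p * g z)) =
         A * (1 + q * h w) * ((g z - g w) * (1 + q * h z))" if z: "z \<in> ball w r" for z
  proof -
    have nzz: "1 + p * g z \<noteq> 0" "1 + q * h z \<noteq> 0" using z r(2) by (auto simp: U_def)
    have "B * (1 + p * g w) * (h z - h w) / (1 + q * h z) =
        A * (1 + q * h w) * (g z - g w) / (1 + p * g z)"
      using F0[OF z] by (simp add: F_def)
    then show ?thesis unfolding frac_eq_eq[OF nzz(2,1)] by (simp only: mult.assoc)
  qed
  show ?thesis
    by (rule analytic_continuation_open[of "ball w r" D, OF _ assms(1) _ assms(2)])
       (use r loc assms in \<open>auto simp: U_def intro!: holomorphic_intros\<close>)
qed

text \<open>With \<open>w\<close> fixed in the separated identity, \<open>h1\<close> and \<open>g1\<close> satisfy a bilinear relation; solving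
  it for \<open>h1\<close> gives the Moebius transformation.\<close>

lemma moebius_of_alpha_eq:
  assumes "open D" "connected D" "D \<noteq> {}"
    and hol: "g1 holomorphic_on D" "g2 holomorphic_on D" "h1 holomorphic_on D" "h2 holomorphic_on D"
    and g': "\<And>z. z \<in> D \<Longrightarrow> deriv g1 z * deriv g2 z \<noteq> 0"
    and h': "\<And>z. z \<in> D \<Longrightarrow> deriv h1 z * deriv h2 z \<noteq> 0"
    and g: "\<And>z. z \<in> D \<Longrightarrow> g1 z * cnj (g2 z) \<noteq> - 1"
    and h: "\<And>z. z \<in> D \<Longrightarrow> h1 z * cnj (h2 z) \<noteq> - 1"
    and eq: "\<And>z. z \<in> D \<Longrightarrow> alpha g1 g2 z = alpha h1 h2 z"
  shows "\<exists>a b c d. a * d - b * c \<noteq> 0 \<and>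
    (\<forall>z\<in>D. c * g1 z + d \<noteq> 0 \<and> h1 z = (a * g1 z + b) / (c * g1 z + d))"
proof -
  obtain w where w: "w \<in> D" using assms(3) by blast
  define p where "p = cnj (g2 w)"
  define q where "q = cnj (h2 w)"
  define s where "s = g1 w"
  define t where "t = h1 w"
  define \<kappa> where "\<kappa> = cnj (deriv g2 w) * (1 + q * t) / (cnj (deriv h2 w) * (1 + p * s))"
  have nz: "1 + p * s \<noteq> 0" "1 + q * t \<noteq> 0" "deriv g2 w \<noteq> 0" "deriv h2 w \<noteq> 0"
    using g[OF w] h[OF w] g'[OF w] h'[OF w] by (auto simp: p_def q_def s_def t_def add_eq_0_iff mult.commute)
  have \<kappa>: "\<kappa> \<noteq> 0" using nz by (simp add: \<kappa>_def)
  have key: "(h1 z - t) * (1 + p * g1 z) = \<kappa> * ((g1 z - s) * (1 + q * h1 z))" if z: "z \<in> D" for z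
  proof -
    have "cnj (deriv h2 w) * deriv h1 z * (1 + p * g1 z)\<^sup>2 = cnj (deriv g2 w) * deriv g1 z * (1 + q * h1 z)\<^sup>2"
      if "z \<in> D" for z
      using polarized_alpha_eq[OF assms(1,2) hol g h eq that w] by (simp add: p_def q_def mult_ac)
    from moebius_of_derivative_eq[OF assms(1,2) hol(1,3) w _ _ this z] nz
    have "cnj (deriv h2 w) * (1 + p * s) * ((h1 z - t) * (1 + p * g1 z)) =
         cnj (deriv g2 w) * (1 + q * t) * ((g1 z - s) * (1 + q * h1 z))"
      unfolding s_def t_def by blast
    moreover have "cnj (deriv g2 w) * (1 + q * t) = \<kappa> * (cnj (deriv h2 w) * (1 + p * s))"
      using nz by (simp add: \<kappa>_def)
    ultimately have "cnj (deriv h2 w) * (1 + p * s) * ((h1 z - t) * (1 + p * g1 z)) =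
        cnj (deriv h2 w) * (1 + p * s) * (\<kappa> * ((g1 z - s) * (1 + q * h1 z)))"
      by (simp only: mult_ac)
    moreover have "cnj (deriv h2 w) * (1 + p * s) \<noteq> 0" using nz by simp
    ultimately show ?thesis by (rule mult_left_cancel[THEN iffD1, rotated])
  qed
  \<comment> \<open>The coefficients of the relation \<open>key\<close> solved for \<open>h1 z\<close>.\<close>
  define a where "a = \<kappa> + t * p"
  define b where "b = t - \<kappa> * s"
  define c where "c = p - \<kappa> * q"
  define d where "d = 1 + \<kappa> * q * s"
  have "a * d - b * c = \<kappa> * ((1 + p * s) * (1 + q * t))"
    by (simp add: a_def b_def c_def d_def algebra_simps)
  then have det: "a * d - b * c \<noteq> 0" using nz \<kappa> by simp
  have "c * g1 z + d \<noteq> 0 \<and> h1 z = (a * g1 z + b) / (c * g1 z + d)" if z: "z \<in> D" for z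
  proof -
    have lin: "h1 z * (c * g1 z + d) = a * g1 z + b"
      using key[OF z] by (simp add: a_def b_def c_def d_def algebra_simps)
    have "c * g1 z + d \<noteq> 0"
    proof
      \<comment> \<open>A common zero of both linear forms contradicts invertibility of the matrix.\<close>
    assume 0: "c * g1 z + d = 0"
      then have "a * g1 z + b = 0" using lin by simp
      moreover have "a * d - b * c = a * (c * g1 z + d) - c * (a * g1 z + b)" by (simp add: algebra_simps)
      ultimately show False using 0 det by simp
    qed
    then show ?thesis using lin by (simp add: field_simps)
  qed
  with det show ?thesis by blast
qed

text \<open>With \<open>h1\<close> expressed by \<open>g1\<close>, the separated identity says that \<open>(A + B x)\<^sup>2\<close> and
  \<open>(1 + G x)\<^sup>2\<close> are proportional for \<open>x = g1(z)\<close>, where \<open>A\<close>, \<open>B\<close> involve \<open>h2(w)\<close> and \<open>G = cnj g2(w)\<close>.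
  Equality of their logarithmic derivatives at \<open>z = w\<close> forces \<open>B = A G\<close>, a linear equation
  for \<open>h2(w)\<close>.\<close>

lemma second_moebius_of_first:
  assumes "open D" "connected D"
    and hol: "g1 holomorphic_on D" "g2 holomorphic_on D" "h1 holomorphic_on D" "h2 holomorphic_on D"
    and g': "\<And>z. z \<in> D \<Longrightarrow> deriv g1 z * deriv g2 z \<noteq> 0"
    and g: "\<And>z. z \<in> D \<Longrightarrow> g1 z * cnj (g2 z) \<noteq> - 1"
    and h: "\<And>z. z \<in> D \<Longrightarrow> h1 z * cnj (h2 z) \<noteq> - 1"
    and eq: "\<And>z. z \<in> D \<Longrightarrow> alpha g1 g2 z = alpha h1 h2 z"
    and det: "a * d - b * c \<noteq> 0"
    and h1: "\<And>z. z \<in> D \<Longrightarrow> c * g1 z + d \<noteq> 0 \<and> h1 z = (a * g1 z + b) / (c * g1 z + d)"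
    and w: "w \<in> D"
  shows "- cnj b * g2 w + cnj a \<noteq> 0 \<and> h2 w = (cnj d * g2 w - cnj c) / (- cnj b * g2 w + cnj a)"
proof -
  define G where "G = cnj (g2 w)"
  define H where "H = cnj (h2 w)"
  define A where "A = d + b * H"
  define B where "B = c + a * H"
  define k where "k = (a * d - b * c) * cnj (deriv h2 w)"
  define \<gamma> where "\<gamma> = cnj (deriv g2 w)"
  have \<gamma>: "\<gamma> \<noteq> 0" using g'[OF w] by (simp add: \<gamma>_def)
  have sq: "\<gamma> * (A + B * g1 z)\<^sup>2 = k * (1 + G * g1 z)\<^sup>2" if z: "z \<in> D" for z
  proof -
    define m where "m = c * g1 z + d"
    have m: "m \<noteq> 0" "h1 z = (a * g1 z + b) / m" using h1[OF z] by (auto simp: m_def)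
    have "1 + h1 z * H = (A + B * g1 z) / m"
      using m by (simp add: A_def B_def field_simps) (simp add: m_def algebra_simps)
    moreover have "deriv h1 z = (a * d - b * c) * deriv g1 z / m\<^sup>2"
      using deriv_moebius[OF assms(1) hol(1) z h1] by (simp add: m_def)
    ultimately have "deriv g1 z * \<gamma> * ((A + B * g1 z) / m)\<^sup>2 =
        (a * d - b * c) * deriv g1 z / m\<^sup>2 * cnj (deriv h2 w) * (1 + g1 z * G)\<^sup>2"
      using polarized_alpha_eq[OF assms(1,2) hol g h eq z w] by (simp add: H_def G_def \<gamma>_def)
    then show ?thesis using m(1) g'[OF z] by (simp add: k_def power_divide mult_ac)
  qed
  define x where "x = g1 w"
  have Gx: "1 + G * x \<noteq> 0" using g[OF w] by (auto simp: G_def x_def add_eq_0_iff mult.commute)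
  have Ax: "A + B * x \<noteq> 0"
  proof -
    have "A + B * x = (c * x + d) * (1 + h1 w * H)"
      using h1[OF w] by (simp add: A_def B_def x_def field_simps)
    moreover have "1 + h1 w * H \<noteq> 0" using h[OF w] by (auto simp: H_def add_eq_0_iff)
    ultimately show ?thesis using h1[OF w] by (simp add: x_def)
  qed
  have dsq: "\<gamma> * ((A + B * x) * B) = k * ((1 + G * x) * G)"
  proof -
    have d: "(g1 has_field_derivative deriv g1 w) (at w)"
      using assms w by (intro holomorphic_derivI)
    have "((\<lambda>z. \<gamma> * (A + B * g1 z)\<^sup>2) has_field_derivative \<gamma> * (2 * (A + B * x) * B) * deriv g1 w) (at w)"
      by (auto intro!: derivative_eq_intros d simp: x_def)
    then have 1: "((\<lambda>z. k * (1 + G * g1 z)\<^sup>2) has_field_derivative \<gamma> * (2 * (A + B * x) * B) * deriv g1 w) (at w)"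
      by (rule has_field_derivative_transform_within_open[OF _ assms(1) w sq])
    have 2: "((\<lambda>z. k * (1 + G * g1 z)\<^sup>2) has_field_derivative k * (2 * (1 + G * x) * G) * deriv g1 w) (at w)"
      by (auto intro!: derivative_eq_intros d simp: x_def)
    from DERIV_unique[OF 1 2] g'[OF w] have "2 * (\<gamma> * ((A + B * x) * B)) = 2 * (k * ((1 + G * x) * G))"
      by (simp add: mult_ac)
    then show ?thesis by simp
  qed
  have "\<gamma> * (A + B * x) * ((A + B * x) * G) = k * (1 + G * x) * ((1 + G * x) * G)"
    using sq[OF w] by (simp add: x_def power2_eq_square mult_ac)
  also have "\<dots> = \<gamma> * (A + B * x) * (B * (1 + G * x))"
    using arg_cong[OF dsq, of "\<lambda>y. y * (1 + G * x)"] by (simp only: mult_ac)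
  finally have "(A + B * x) * G = B * (1 + G * x)" using \<gamma> Ax by simp
  then have "A * G = B" by (simp add: algebra_simps)
  then have lin: "H * (a - b * G) = d * G - c" by (simp add: A_def B_def algebra_simps)
  have nz: "a - b * G \<noteq> 0"
  proof
    assume 0: "a - b * G = 0"
    then have "d * G - c = 0" using lin by simp
    moreover have "a * d - b * c = d * (a - b * G) + b * (d * G - c)" by (simp add: algebra_simps)
    ultimately show False using 0 det by simp
  qed
  have "cnj H * cnj (a - b * G) = cnj (d * G - c)" using lin by (metis complex_cnj_mult)
  moreover have "cnj (a - b * G) \<noteq> 0" using nz complex_cnj_zero_iff by blast
  ultimately show ?thesis by (simp add: G_def H_def field_simps)
qed

section \<open>Pairs that generate the same solution\<close>

theorem theorem2:
  fixes D :: "complex set" and g1 g2 h1 h2 :: "complex \<Rightarrow> complex"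
  assumes "open D" and "connected D" and "D \<noteq> {}"
    and "g1 holomorphic_on D" and "g2 holomorphic_on D"
    and "\<And>z. z \<in> D \<Longrightarrow> deriv g1 z * deriv g2 z \<noteq> 0"
    and "\<And>z. z \<in> D \<Longrightarrow> g1 z * cnj (g2 z) \<noteq> - 1"
    and "h1 holomorphic_on D" and "h2 holomorphic_on D"
    and "\<And>z. z \<in> D \<Longrightarrow> deriv h1 z * deriv h2 z \<noteq> 0"
    and "\<And>z. z \<in> D \<Longrightarrow> h1 z * cnj (h2 z) \<noteq> - 1"
  shows "(\<exists>K \<kappa>. solution_on D K \<kappa> \<and> generates_on D g1 g2 K \<kappa> \<and> generates_on D h1 h2 K \<kappa>) \<longleftrightarrow>
    (\<exists>a b c d :: complex. a * d - b * c \<noteq> 0 \<and>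
       (\<forall>z\<in>D. c * g1 z + d \<noteq> 0 \<and> h1 z = (a * g1 z + b) / (c * g1 z + d) \<and>
               - cnj b * g2 z + cnj a \<noteq> 0 \<and>
               h2 z = (cnj d * g2 z - cnj c) / (- cnj b * g2 z + cnj a)))"
proof
  assume "\<exists>K \<kappa>. solution_on D K \<kappa> \<and> generates_on D g1 g2 K \<kappa> \<and> generates_on D h1 h2 K \<kappa>"
  then have eq: "alpha g1 g2 z = alpha h1 h2 z" if "z \<in> D" for z
    using alpha_eq_of_generates_same that by blast
  have "\<exists>a b c d. a * d - b * c \<noteq> 0 \<and>
      (\<forall>z\<in>D. c * g1 z + d \<noteq> 0 \<and> h1 z = (a * g1 z + b) / (c * g1 z + d))"
    by (rule moebius_of_alpha_eq[OF assms(1,2,3,4,5,8,9,6,10,7,11) eq])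
  then obtain a b c d where det: "a * d - b * c \<noteq> 0"
    and h1: "\<And>z. z \<in> D \<Longrightarrow> c * g1 z + d \<noteq> 0 \<and> h1 z = (a * g1 z + b) / (c * g1 z + d)"
    by blast
  have "- cnj b * g2 z + cnj a \<noteq> 0 \<and> h2 z = (cnj d * g2 z - cnj c) / (- cnj b * g2 z + cnj a)"
    if "z \<in> D" for z
    by (rule second_moebius_of_first[OF assms(1,2,4,5,8,9,6,7,11) eq det h1 that])
  with det h1 show "\<exists>a b c d :: complex. a * d - b * c \<noteq> 0 \<and>
       (\<forall>z\<in>D. c * g1 z + d \<noteq> 0 \<and> h1 z = (a * g1 z + b) / (c * g1 z + d) \<and>
               - cnj b * g2 z + cnj a \<noteq> 0 \<and>
               h2 z = (cnj d * g2 z - cnj c) / (- cnj b * g2 z + cnj a))"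
    by blast
next
  assume "\<exists>a b c d :: complex. a * d - b * c \<noteq> 0 \<and>
       (\<forall>z\<in>D. c * g1 z + d \<noteq> 0 \<and> h1 z = (a * g1 z + b) / (c * g1 z + d) \<and>
               - cnj b * g2 z + cnj a \<noteq> 0 \<and>
               h2 z = (cnj d * g2 z - cnj c) / (- cnj b * g2 z + cnj a))"
  then obtain a b c d where det: "a * d - b * c \<noteq> 0"
    and h1: "\<And>z. z \<in> D \<Longrightarrow> c * g1 z + d \<noteq> 0 \<and> h1 z = (a * g1 z + b) / (c * g1 z + d)"
    and h2: "\<And>z. z \<in> D \<Longrightarrow> - cnj b * g2 z + cnj a \<noteq> 0 \<and>
        h2 z = (cnj d * g2 z + - cnj c) / (- cnj b * g2 z + cnj a)"
    by auto
  have "alpha h1 h2 z = alpha g1 g2 z" if "z \<in> D" for z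
    by (rule alpha_moebius_invariant[OF assms(1,4,5) that det h1 h2])
  then have "generates_on D h1 h2 (\<lambda>z. cmod (alpha g1 g2 z) * Re (alpha g1 g2 z))
      (\<lambda>z. cmod (alpha g1 g2 z) * Im (alpha g1 g2 z))"
    by (simp add: generates_on_def)
  moreover have "generates_on D g1 g2 (\<lambda>z. cmod (alpha g1 g2 z) * Re (alpha g1 g2 z))
      (\<lambda>z. cmod (alpha g1 g2 z) * Im (alpha g1 g2 z))"
    by (simp add: generates_on_def)
  moreover have "solution_on D (\<lambda>z. cmod (alpha g1 g2 z) * Re (alpha g1 g2 z))
      (\<lambda>z. cmod (alpha g1 g2 z) * Im (alpha g1 g2 z))"
    by (rule generated_solution[OF assms(1,4,5,6,7)])
  ultimately show "\<exists>K \<kappa>. solution_on D K \<kappa> \<and> generates_on D g1 g2 K \<kappa> \<and> generates_on D h1 h2 K \<kappa>"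
    by blast
qed

end
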